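(* Let $K:\mathbb{X}\to\mathbb{Y}$ be a linear operator between two finite-dimensional Euclidean spaces and let $h:\mathbb{Y}\to\mathbb{R}\cup\{+\infty\}$ be a lower semicontinuous polyhedral convex function with $K^{-1}(\operatorname{dom}h)\neq\emptyset$. Define $g(x):=h(Kx)$ for $x\in\mathbb{X}$. Then for any $z\in\operatorname{dom}g^*$ we have $$\operatorname{par}\partial g^*(z)=K^{-1}\big(\operatorname{par}(\partial h^*(y)\cap\operatorname{Im}K)\big)$$ for any $y\in\mathbb{Y}$ satisfying $K^*y=z$ and $g^*(z)=h^*(y)$.
   Context: $g^*$ and $h^*$ are the Legendre–Fenchel conjugates of $g$ and $h$, $\partial$ is the convex subdifferential, $K^*$ is the adjoint of $K$, $\operatorname{Im}K$ is its range, and $K^{-1}(B)$ is the preimage of a set $B$. For a nonempty convex set $C$, its parallel subspace is $\operatorname{par}C:=\operatorname{span}(C-x)$ for any $x\in C$. A function is polyhedral convex if its epigraph is the intersection of finitely many closed half-spaces. *)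

theory Defs
  imports "HOL-Analysis.Analysis"
begin

text \<open>Functions with values in the reals together with \<open>+\<infinity>\<close> are modelled as
  \<^typ>\<open>ereal\<close>-valued functions; that \<open>-\<infinity>\<close> is not attained is a separate hypothesis.\<close>

definition eff_dom :: "('a \<Rightarrow> ereal) \<Rightarrow> 'a set" where
  "eff_dom f = {x. f x < \<infinity>}"

definition lsc :: "('a::topological_space \<Rightarrow> ereal) \<Rightarrow> bool" where
  "lsc f \<longleftrightarrow> (\<forall>x. f x \<le> Liminf (at x) f)"

definition epi :: "('a \<Rightarrow> ereal) \<Rightarrow> ('a \<times> real) set" where
  "epi f = {(x, r). f x \<le> ereal r}"

text \<open>Convexity need not be required separately, an intersection of half-spaces being convex.\<close>

definition polyhedral_convex :: "('a::euclidean_space \<Rightarrow> ereal) \<Rightarrow> bool" where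
  "polyhedral_convex f \<longleftrightarrow> polyhedron (epi f)"

definition fenchel_conj :: "('a::real_inner \<Rightarrow> ereal) \<Rightarrow> 'a \<Rightarrow> ereal" where
  "fenchel_conj f z = (SUP x. ereal (z \<bullet> x) - f x)"

text \<open>By the usual convention, the subdifferential is empty where \<open>f\<close> is not finite.\<close>

definition subdiff :: "('a::real_inner \<Rightarrow> ereal) \<Rightarrow> 'a \<Rightarrow> 'a set" where
  "subdiff f x = {v. \<bar>f x\<bar> \<noteq> \<infinity> \<and> (\<forall>u. f x + ereal (v \<bullet> (u - x)) \<le> f u)}"

text \<open>Meaningful for nonempty \<open>C\<close> only; \<open>par_eq\<close> shows that the base point is immaterial.\<close>

definition par :: "'a::real_vector set \<Rightarrow> 'a set" where
  "par C = span ((\<lambda>c. c - (SOME x. x \<in> C)) ` C)"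

lemma span_diff_subset:
  fixes C :: "'a::real_vector set"
  assumes "y \<in> C"
  shows "span ((\<lambda>c. c - y) ` C) \<subseteq> span ((\<lambda>c. c - x) ` C)"
proof (rule span_minimal)
  show "(\<lambda>c. c - y) ` C \<subseteq> span ((\<lambda>c. c - x) ` C)"
  proof
    fix v assume "v \<in> (\<lambda>c. c - y) ` C"
    then obtain c where c: "c \<in> C" "v = (c - x) - (y - x)" by auto
    show "v \<in> span ((\<lambda>c. c - x) ` C)"
      unfolding c(2) by (intro span_diff span_base imageI c(1) assms)
  qed
qed (rule subspace_span)

lemma par_eq:
  assumes "x \<in> C"
  shows "par C = span ((\<lambda>c. c - x) ` C)"
proof -
  have "(SOME x. x \<in> C) \<in> C" using assms by (rule someI)
  then show ?thesis
    unfolding par_def using assms by (intro equalityI span_diff_subset)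
qed

end

theory Submission
  imports Defs
begin

text \<open>
  Both conjugates take the same value at \<open>z\<close> and \<open>y\<close>, and \<open>\<langle>x, z\<rangle> = \<langle>K x, y\<rangle>\<close>. For a function \<open>f\<close> with
  closed convex epigraph that never takes the value \<open>-\<infinity>\<close>, \<open>v \<in> \<partial>f\<^sup>*(w)\<close> means that \<open>f\<^sup>*(w)\<close> is finite and the Fenchel--Young inequality
  is an equality, \<open>f(v) = \<langle>v, w\<rangle> - f\<^sup>*(w)\<close> (\<open>subdiff_fenchel_conj_iff\<close>). Applied to \<open>g\<close> at \<open>z\<close> and to \<open>h\<close> at
  \<open>y\<close>, this turns the two subdifferentials into the same condition on \<open>h(K x)\<close>, so that
  \<open>\<partial>g\<^sup>*(z) = K\<^sup>-\<^sup>1(\<partial>h\<^sup>*(y))\<close>. What remains is the linear algebra fact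
  \<open>par (K\<^sup>-\<^sup>1(C)) = K\<^sup>-\<^sup>1(par (C \<inter> Im K))\<close> (\<open>par_linear_vimage\<close>), which fails when \<open>K\<^sup>-\<^sup>1(C)\<close> is empty and \<open>K\<close> is
  not injective.

  Nonemptiness of \<open>\<partial>g\<^sup>*(z)\<close> is where polyhedrality enters: it says that the supremum defining \<open>g\<^sup>*(z)\<close>
  is attained (\<open>fenchel_conj_attained\<close>). That supremum is the value of a linear program over the
  epigraph of \<open>g\<close>, which is a polyhedron as the linear preimage of the epigraph of \<open>h\<close>; and a linear
  functional bounded above on a nonempty polyhedron attains its supremum
  (\<open>polyhedron_attains_sup_linear\<close>).
\<close>

section \<open>Subgradients of the conjugate\<close>

lemma fenchel_conj_le_iff:
  assumes "\<forall>x. f x \<noteq> -\<infinity>"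
  shows "fenchel_conj f w \<le> ereal r \<longleftrightarrow> (\<forall>(x, s) \<in> epi f. w \<bullet> x - s \<le> r)"
proof -
  have "ereal (w \<bullet> x) - f x \<le> ereal r \<longleftrightarrow> (\<forall>s. f x \<le> ereal s \<longrightarrow> w \<bullet> x - s \<le> r)" for x
  proof (cases "f x")
    case (real t)
    then show ?thesis by (auto intro: order_trans[rotated])
  qed (use assms in auto)
  then show ?thesis
    unfolding fenchel_conj_def epi_def by (auto simp: SUP_le_iff)
qed

lemma fenchel_young: "ereal (w \<bullet> x) - f x \<le> fenchel_conj f w"
  unfolding fenchel_conj_def by (rule SUP_upper) simp

text \<open>
  The left-to-right direction is the part of the Fenchel--Moreau theorem needed here. If \<open>(v, r)\<close>
  with \<open>r = \<langle>v, z\<rangle> - f\<^sup>*(z)\<close> lies outside the epigraph, a separating hyperplane yields a point \<open>w\<close> at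
  which \<open>f\<^sup>*\<close> violates the subgradient inequality.
\<close>

lemma subdiff_fenchel_conj_iff:
  fixes f :: "'a::euclidean_space \<Rightarrow> ereal"
  assumes "convex (epi f)" and "closed (epi f)" and finite_below: "\<forall>x. f x \<noteq> -\<infinity>"
  shows "v \<in> subdiff (fenchel_conj f) z \<longleftrightarrow>
    \<bar>fenchel_conj f z\<bar> \<noteq> \<infinity> \<and> f v = ereal (v \<bullet> z) - fenchel_conj f z"
proof (cases "fenchel_conj f z")
  case (real m)
  define r where "r = v \<bullet> z - m"
  have "f v = ereal r" if sub: "\<And>u. ereal m + ereal (v \<bullet> (u - z)) \<le> fenchel_conj f u"
  proof (rule antisym)
    show "ereal r \<le> f v"
      using fenchel_young[of z v f] real finite_below
      by (cases "f v") (auto simp: r_def inner_commute)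
    show "f v \<le> ereal r"
    proof (rule ccontr)
      assume "\<not> f v \<le> ereal r"
      then have "(v, r) \<notin> epi f" by (simp add: epi_def)
      from separating_hyperplane_closed_point[OF assms(1,2) this]
      obtain a \<alpha> b where below: "a \<bullet> v + \<alpha> * r < b"
        and above: "\<And>x s. (x, s) \<in> epi f \<Longrightarrow> b < a \<bullet> x + \<alpha> * s"
        by (force simp: inner_prod_def)
      have young: "z \<bullet> x - s \<le> m" if "(x, s) \<in> epi f" for x s
        using fenchel_conj_le_iff[OF finite_below, of z m] real that by auto
      have "epi f \<noteq> {}"
        using fenchel_conj_le_iff[OF finite_below, of z "m - 1"] real by auto
      then obtain x s where xs: "(x, s) \<in> epi f" by auto
      have "\<alpha> \<ge> 0"
      proof (rule ccontr)
        assume "\<not> \<alpha> \<ge> 0"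
        define t where "t = \<bar>(a \<bullet> x + \<alpha> * s - b) / \<alpha>\<bar>"
        have "f x \<le> ereal s" using xs by (simp add: epi_def)
        also have "\<dots> \<le> ereal (s + t)" by (simp add: t_def)
        finally have "(x, s + t) \<in> epi f" by (simp add: epi_def)
        from above[OF this] have "b < a \<bullet> x + \<alpha> * s + \<alpha> * t" by (simp add: algebra_simps)
        moreover have "\<alpha> * t = - (a \<bullet> x + \<alpha> * s - b)"
          using \<open>\<not> \<alpha> \<ge> 0\<close> above[OF xs] by (simp add: t_def abs_divide)
        ultimately show False by simp
      qed
      \<comment> \<open>Adding the separating inequality to the Fenchel--Young inequality at \<open>z\<close> makes the
        coefficient of the last coordinate nonzero, whether or not the hyperplane is vertical.\<close>
      define \<beta> where "\<beta> = 1 + \<alpha>"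
      have \<beta>: "\<beta> > 0" using \<open>\<alpha> \<ge> 0\<close> by (simp add: \<beta>_def)
      define w where "w = (1 / \<beta>) *\<^sub>R (z - a)"
      have "fenchel_conj f w \<le> ereal ((m - b) / \<beta>)"
      proof (subst fenchel_conj_le_iff[OF finite_below], clarify)
        fix x s assume "(x, s) \<in> epi f"
        then have "(z - a) \<bullet> x - \<beta> * s \<le> m - b"
          using above young by (fastforce simp: \<beta>_def algebra_simps)
        then have "((z - a) \<bullet> x - \<beta> * s) / \<beta> \<le> (m - b) / \<beta>"
          using \<beta> by (simp add: divide_right_mono)
        then show "w \<bullet> x - s \<le> (m - b) / \<beta>"
          using \<beta> by (simp add: w_def diff_divide_distrib)
      qed
      with sub[of w] have "ereal (m + v \<bullet> (w - z)) \<le> ereal ((m - b) / \<beta>)"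
        by (metis order_trans plus_ereal.simps(1))
      then have "\<beta> * (m + v \<bullet> (w - z)) \<le> m - b"
        using \<beta> by (simp add: pos_le_divide_eq mult.commute)
      moreover have "\<beta> * (v \<bullet> w) = v \<bullet> (z - a)"
        using \<beta> by (simp add: w_def)
      ultimately show False
        using below by (simp add: \<beta>_def r_def inner_diff_right inner_commute algebra_simps)
    qed
  qed
  moreover have "ereal m + ereal (v \<bullet> (u - z)) \<le> fenchel_conj f u" if "f v = ereal r" for u
    using fenchel_young[of u v f] that
    by (simp add: r_def inner_diff_right inner_commute algebra_simps)
  ultimately show ?thesis
    using real by (auto simp: subdiff_def r_def)
qed (auto simp: subdiff_def)

section \<open>Linear programs attain their value\<close>

text \<open>
  A functional that is bounded above but not constant on \<open>S\<close> increases along some direction of the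
  affine hull of \<open>S\<close>. Moving from \<open>p\<close> in that direction must leave \<open>S\<close> by boundedness, and the last point in \<open>S\<close> lies on a facet.
\<close>

lemma polyhedron_boundary_point_above:
  fixes S :: "'a::euclidean_space set"
  assumes "polyhedron S" and bound: "\<And>x. x \<in> S \<Longrightarrow> c \<bullet> x \<le> M"
    and "u \<in> S" "v \<in> S" "c \<bullet> u < c \<bullet> v" and "p \<in> S"
  obtains F q where "F facet_of S" "q \<in> F" "c \<bullet> p \<le> c \<bullet> q"
proof -
  define d where "d = v - u"
  have d: "c \<bullet> d > 0" using assms by (simp add: d_def inner_diff_right)
  define T where "T = {0..} \<inter> (\<lambda>t. p + t *\<^sub>R d) -` S"
  have "closed T"
    unfolding T_def using polyhedron_imp_closed[OF \<open>polyhedron S\<close>]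
    by (intro closed_Int closed_vimage continuous_intros) auto
  moreover have "T \<subseteq> {0..(M - c \<bullet> p) / (c \<bullet> d)}"
    using d bound by (fastforce simp: T_def pos_le_divide_eq inner_add_right)
  then have "bounded T" using bounded_closed_interval bounded_subset by blast
  ultimately have "compact T" by (simp add: compact_eq_bounded_closed)
  moreover have "0 \<in> T" using \<open>p \<in> S\<close> by (simp add: T_def)
  ultimately obtain t where "t \<in> T" and max: "\<And>s. s \<in> T \<Longrightarrow> s \<le> t"
    using compact_attains_sup[of T] by blast
  define q where "q = p + t *\<^sub>R d"
  have "q \<in> S" "t \<ge> 0" using \<open>t \<in> T\<close> by (auto simp: T_def q_def)
  have "q \<notin> rel_interior S"
  proof
    assume q: "q \<in> rel_interior S"
    \<comment> \<open>Prolonging the segment from \<open>q - d\<close> slightly beyond \<open>q\<close> contradicts the maximality of \<open>t\<close>.\<close>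
    have "q + 1 *\<^sub>R (u - v) \<in> affine hull S"
      using \<open>q \<in> S\<close> assms by (intro mem_affine_3_minus affine_affine_hull hull_inc)
    then have "q - d \<in> affine hull S" by (simp add: d_def algebra_simps)
    with convex_rel_interior_if[OF polyhedron_imp_convex[OF \<open>polyhedron S\<close>] q]
    obtain e where e: "e > 1" "(1 - e) *\<^sub>R (q - d) + e *\<^sub>R q \<in> S" by blast
    have "(1 - e) *\<^sub>R (q - d) + e *\<^sub>R q = p + (t + (e - 1)) *\<^sub>R d"
      by (simp add: q_def algebra_simps)
    with e \<open>t \<ge> 0\<close> have "t + (e - 1) \<in> T" by (simp add: T_def)
    from max[OF this] \<open>e > 1\<close> show False by simp
  qed
  with \<open>q \<in> S\<close> rel_boundary_of_polyhedron[OF \<open>polyhedron S\<close>]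
  obtain F where "F facet_of S" "q \<in> F" by blast
  moreover have "c \<bullet> p \<le> c \<bullet> q" using d \<open>t \<ge> 0\<close> by (simp add: q_def inner_add_right)
  ultimately show ?thesis using that by blast
qed

text \<open>
  Induction on the dimension: the supremum over \<open>S\<close> is the largest of the finitely many suprema over
  the facets, unless the functional is constant on \<open>S\<close>.
\<close>

lemma polyhedron_attains_sup_linear:
  fixes S :: "'a::euclidean_space set"
  assumes "polyhedron S" "S \<noteq> {}" "\<And>x. x \<in> S \<Longrightarrow> c \<bullet> x \<le> M"
  obtains x where "x \<in> S" "\<And>y. y \<in> S \<Longrightarrow> c \<bullet> y \<le> c \<bullet> x"
proof -
  have "\<exists>x\<in>S. \<forall>y\<in>S. c \<bullet> y \<le> c \<bullet> x"
    using assms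
  proof (induction "nat (aff_dim S)" arbitrary: S rule: less_induct)
    case less
    show ?case
    proof (cases "\<exists>u\<in>S. \<exists>v\<in>S. c \<bullet> u < c \<bullet> v")
      case False
      then show ?thesis using less.prems(2) by (force simp: not_less)
    next
      case True
      have above: "\<exists>F q. F facet_of S \<and> q \<in> F \<and> c \<bullet> p \<le> c \<bullet> q" if "p \<in> S" for p
        using True polyhedron_boundary_point_above[OF less.prems(1,3) _ _ _ that] by metis
      have "\<exists>x\<in>F. \<forall>y\<in>F. c \<bullet> y \<le> c \<bullet> x" if F: "F facet_of S" for F
      proof (rule less.hyps)
        have "F \<noteq> {}" "aff_dim F = aff_dim S - 1" using F by (auto simp: facet_of_def)
        moreover have "aff_dim F \<ge> 0" using \<open>F \<noteq> {}\<close> using aff_dim_negative_iff[of F] by linarith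
        ultimately show "nat (aff_dim F) < nat (aff_dim S)" "F \<noteq> {}" by auto
        show "polyhedron F"
          using F less.prems(1) facet_of_imp_face_of face_of_polyhedron_polyhedron by blast
        show "c \<bullet> x \<le> M" if "x \<in> F" for x
          using that F facet_of_imp_subset less.prems(3) by blast
      qed
      then obtain \<mu> where \<mu>: "\<And>F. F facet_of S \<Longrightarrow> \<mu> F \<in> F"
        "\<And>F y. F facet_of S \<Longrightarrow> y \<in> F \<Longrightarrow> c \<bullet> y \<le> c \<bullet> \<mu> F"
        by metis
      define V where "V = (\<lambda>F. c \<bullet> \<mu> F) ` {F. F facet_of S}"
      have "finite V" using finite_polyhedron_facets[OF less.prems(1)] by (simp add: V_def)
      moreover have "V \<noteq> {}" using above less.prems(2) by (auto simp: V_def)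
      ultimately have "Max V \<in> V" by simp
      then obtain F where F: "F facet_of S" "Max V = c \<bullet> \<mu> F" by (auto simp: V_def)
      have "c \<bullet> y \<le> c \<bullet> \<mu> F" if y: "y \<in> S" for y
      proof -
        obtain G q where G: "G facet_of S" "q \<in> G" "c \<bullet> y \<le> c \<bullet> q"
          using above[OF y] by blast
        then have "c \<bullet> y \<le> c \<bullet> \<mu> G" using \<mu>(2) by force
        also have "\<dots> \<le> Max V" using G \<open>finite V\<close> by (auto simp: V_def)
        finally show ?thesis by (simp add: F)
      qed
      moreover have "\<mu> F \<in> S" using F \<mu>(1) facet_of_imp_subset by blast
      ultimately show ?thesis by blast
    qed
  qed
  then show ?thesis using that by blast
qed

lemma polyhedron_linear_vimage:
  fixes L :: "'a::euclidean_space \<Rightarrow> 'b::euclidean_space"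
  assumes "linear L" and "polyhedron S"
  shows "polyhedron (L -` S)"
proof -
  obtain \<H> where \<H>: "finite \<H>" "S = \<Inter>\<H>" "\<And>H. H \<in> \<H> \<Longrightarrow> \<exists>a b. H = {x. a \<bullet> x \<le> b}"
    using assms(2) unfolding polyhedron_def by metis
  have "polyhedron (L -` H)" if "H \<in> \<H>" for H
  proof -
    obtain a b where "H = {x. a \<bullet> x \<le> b}" using \<H>(3) \<open>H \<in> \<H>\<close> by blast
    then have "L -` H = {x. adjoint L a \<bullet> x \<le> b}"
      by (auto simp: adjoint_works[OF assms(1)] inner_commute)
    then show ?thesis by (simp add: polyhedron_halfspace_le)
  qed
  then have "polyhedron (\<Inter>H\<in>\<H>. L -` H)" using \<H>(1) by (intro polyhedron_Inter) auto
  moreover have "L -` S = (\<Inter>H\<in>\<H>. L -` H)" by (auto simp: \<H>(2))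
  ultimately show ?thesis by simp
qed

lemma fenchel_conj_attained:
  fixes f :: "'a::euclidean_space \<Rightarrow> ereal"
  assumes "polyhedral_convex f" and finite_below: "\<forall>x. f x \<noteq> -\<infinity>"
    and fin: "\<bar>fenchel_conj f z\<bar> \<noteq> \<infinity>"
  obtains x where "f x = ereal (x \<bullet> z) - fenchel_conj f z"
proof -
  obtain m where m: "fenchel_conj f z = ereal m" using fin by auto
  have "epi f \<noteq> {}"
    using fenchel_conj_le_iff[OF finite_below, of z "m - 1"] m by auto
  moreover have "(z, -1) \<bullet> p \<le> m" if "p \<in> epi f" for p
    using fenchel_conj_le_iff[OF finite_below, of z m] m that
    by (cases p) (auto simp: inner_prod_def)
  ultimately obtain p where p: "p \<in> epi f" "\<And>q. q \<in> epi f \<Longrightarrow> (z, -1) \<bullet> q \<le> (z, -1) \<bullet> p"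
    using polyhedron_attains_sup_linear[of "epi f" "(z, -1)" m] assms(1)
    unfolding polyhedral_convex_def by metis
  obtain x s where xs: "p = (x, s)" by (cases p)
  have "fenchel_conj f z \<le> ereal (z \<bullet> x - s)"
    using p(2) by (subst fenchel_conj_le_iff[OF finite_below]) (auto simp: xs inner_prod_def)
  moreover have "f x \<le> ereal s" using p(1) by (simp add: xs epi_def)
  ultimately have "f x = ereal (x \<bullet> z) - fenchel_conj f z"
    using fenchel_young[of z x f] m finite_below
    by (cases "f x") (auto simp: inner_commute)
  then show ?thesis by (rule that)
qed

section \<open>Parallel subspaces and preimages\<close>

lemma par_linear_vimage:
  fixes K :: "'a::real_vector \<Rightarrow> 'b::real_vector"
  assumes "linear K" and "K -` C \<noteq> {}"
  shows "par (K -` C) = K -` par (C \<inter> range K)"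
proof -
  obtain x where x: "x \<in> K -` C" using assms(2) by blast
  define A where "A = (\<lambda>c. c - x) ` (K -` C)"
  have A_iff: "a \<in> A \<longleftrightarrow> K (a + x) \<in> C" for a
    by (force simp: A_def image_iff intro: bexI[of _ "a + x"])
  have "(\<lambda>c. c - K x) ` (C \<inter> range K) = K ` A"
    by (force simp: A_def linear_diff[OF assms(1)])
  then have "par (C \<inter> range K) = K ` span A"
    using x par_eq[of "K x" "C \<inter> range K"] linear_span_image[OF assms(1), of A] by simp
  moreover have "w \<in> span A" if "K w = K a" "a \<in> span A" for w a
  proof -
    \<comment> \<open>\<open>A\<close> contains the kernel of \<open>K\<close>.\<close>
    have "w - a \<in> A"
      using that(1) x by (simp add: A_iff linear_add[OF assms(1)] linear_diff[OF assms(1)])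
    then have "w - a \<in> span A" by (rule span_base)
    from span_add[OF that(2) this] show ?thesis by simp
  qed
  ultimately show ?thesis
    using par_eq[OF x] by (auto simp: A_def)
qed

section \<open>Composition of a polyhedral function with a linear map\<close>

theorem proposition4p3:
  fixes K :: "'a::euclidean_space \<Rightarrow> 'b::euclidean_space"
    and h :: "'b \<Rightarrow> ereal"
    and g :: "'a \<Rightarrow> ereal"
    and z :: 'a
    and y :: 'b
  assumes "linear K"
    and "\<forall>u. h u \<noteq> -\<infinity>"
    and "lsc h"
    and "polyhedral_convex h"
    and "K -` eff_dom h \<noteq> {}"
    and "\<forall>x. g x = h (K x)"
    and "z \<in> eff_dom (fenchel_conj g)"
    and "adjoint K y = z"
    and "fenchel_conj g z = fenchel_conj h y"
  shows "par (subdiff (fenchel_conj g) z) = K -` par (subdiff (fenchel_conj h) y \<inter> range K)"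
proof -
  have "epi g = (\<lambda>(x, r). (K x, r)) -` epi h"
    using assms(6) by (auto simp: epi_def)
  moreover have "linear (\<lambda>(x, r). (K x, r :: real))"
    using assms(1) by (auto intro!: linearI simp: linear_add linear_cmul)
  ultimately have g_poly: "polyhedral_convex g"
    using assms(4) by (simp add: polyhedral_convex_def polyhedron_linear_vimage)
  have g_below: "\<forall>x. g x \<noteq> -\<infinity>" using assms(2,6) by simp
  have subdiff_iff: "v \<in> subdiff (fenchel_conj f) w \<longleftrightarrow>
      \<bar>fenchel_conj f w\<bar> \<noteq> \<infinity> \<and> f v = ereal (v \<bullet> w) - fenchel_conj f w"
    if "polyhedral_convex f" "\<forall>x. f x \<noteq> -\<infinity>"
    for f :: "'c::euclidean_space \<Rightarrow> ereal" and v w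
    using that unfolding polyhedral_convex_def
    by (intro subdiff_fenchel_conj_iff polyhedron_imp_convex polyhedron_imp_closed)
  have vimage: "subdiff (fenchel_conj g) z = K -` subdiff (fenchel_conj h) y"
  proof (rule set_eqI)
    fix x
    have "x \<bullet> z = K x \<bullet> y" using adjoint_works[OF assms(1)] assms(8) by metis
    moreover have "g x = h (K x)" using assms(6) by blast
    ultimately show "x \<in> subdiff (fenchel_conj g) z \<longleftrightarrow> x \<in> K -` subdiff (fenchel_conj h) y"
      unfolding vimage_eq subdiff_iff[OF g_poly g_below] subdiff_iff[OF assms(4,2)] assms(9)
      by simp
  qed
  obtain x where "h (K x) < \<infinity>" using assms(5) by (auto simp: eff_dom_def)
  then have "fenchel_conj g z \<noteq> -\<infinity>"
    using fenchel_young[of z x g] assms(2,6) by (cases "h (K x)") auto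
  moreover have "fenchel_conj g z \<noteq> \<infinity>" using assms(7) by (simp add: eff_dom_def)
  ultimately have fin: "\<bar>fenchel_conj g z\<bar> \<noteq> \<infinity>" by auto
  obtain x0 where "g x0 = ereal (x0 \<bullet> z) - fenchel_conj g z"
    using fenchel_conj_attained[OF g_poly g_below fin] .
  with fin have "x0 \<in> subdiff (fenchel_conj g) z"
    unfolding subdiff_iff[OF g_poly g_below] by (rule conjI)
  then have "subdiff (fenchel_conj g) z \<noteq> {}" by fast
  then show ?thesis
    using par_linear_vimage[OF assms(1), of "subdiff (fenchel_conj h) y"] by (simp add: vimage)
qed

end
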